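(* There is an online algorithm for the single-item Byzantine secretary problem which, for every instance (with at least two green items) and every adversary, selects an item of value at least $\mathrm{OPT}(\mathcal{G}\setminus g_{\max})$ with probability $\Omega(1/\log n)$.
   Context: Single-item Byzantine secretary problem. There are $n$ items (the algorithm knows $n$), each with a real value $\mathrm{val}(e)$. The items are partitioned, unknown to the algorithm, into green items $\mathcal{G}$ and red items. An adversary chooses all values and the arrival times in $[0,1]$ of the red items; each green item independently chooses a uniformly random arrival time in $[0,1]$. Items are revealed in order of arrival with their values, and the algorithm may irrevocably select at most one item, at its arrival. $g_{\max}$ denotes the green item of largest value and $\mathrm{OPT}(\mathcal{G}\setminus g_{\max})$ equals the value of the second most valuable green item $g_2$. The probability is over the random arrival times of the green items and the algorithm's internal randomness. *)

theory Defs
  imports "HOL-Probability.Probability"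
begin

text \<open>
  Items are the labels \<open>0, ..., n - 1\<close>. Labels are never shown to the algorithm, which sees only
  arrival times and values. Since the adversary chooses the labelling, it also decides the order in
  which simultaneous items are revealed: \<^const>\<open>sort_key\<close> is stable and breaks ties by label.
\<close>

definition arrival_order :: "nat \<Rightarrow> (nat \<Rightarrow> real) \<Rightarrow> nat list" where
  "arrival_order n t = sort_key t [0..<n]"

definition history :: "nat \<Rightarrow> (nat \<Rightarrow> real) \<Rightarrow> (nat \<Rightarrow> real) \<Rightarrow> nat \<Rightarrow> (real \<times> real) list" where
  "history n v t k = map (\<lambda>e. (t e, v e)) (take k (arrival_order n t))"

text \<open>
  A decision rule says, given the (time, value) pairs revealed so far, whether to select the item
  that has just arrived; the first positive decision is irrevocable and later ones are void.
\<close>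

definition selects ::
  "((real \<times> real) list \<Rightarrow> bool) \<Rightarrow> nat \<Rightarrow> (nat \<Rightarrow> real) \<Rightarrow> (nat \<Rightarrow> real) \<Rightarrow> nat \<Rightarrow> bool" where
  "selects D n v t e \<longleftrightarrow>
     (\<exists>i<n. arrival_order n t ! i = e \<and> D (history n v t (Suc i)) \<and>
            (\<forall>j<i. \<not> D (history n v t (Suc j))))"

text \<open>
  A randomized algorithm draws a seed from \<open>S\<close> (its internal randomness) and then follows the
  decision rule \<open>A seed\<close>. Decisions must be jointly measurable in the seed and in the
  history, for each history length \<open>k\<close>.
\<close>

definition online_algorithm :: "'r measure \<Rightarrow> ('r \<Rightarrow> (real \<times> real) list \<Rightarrow> bool) \<Rightarrow> bool" where
  "online_algorithm S A \<longleftrightarrow> prob_space S \<and>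
     (\<forall>k. (\<lambda>(\<omega>, x). A \<omega> (map x [0..<k]))
            \<in> measurable (S \<Otimes>\<^sub>M PiM {..<k} (\<lambda>_. borel)) (count_space UNIV))"

text \<open>
  An instance consists of the green items \<open>G\<close> (all others are red), the values of all items, and the
  arrival times \<open>r\<close> of the red items; \<open>r\<close> is irrelevant on \<open>G\<close>.
\<close>

definition byzantine_instance :: "nat \<Rightarrow> nat set \<Rightarrow> (nat \<Rightarrow> real) \<Rightarrow> bool" where
  "byzantine_instance n G r \<longleftrightarrow> G \<subseteq> {..<n} \<and> (\<forall>e \<in> {..<n} - G. r e \<in> {0..1})"

definition green_times :: "nat set \<Rightarrow> (nat \<Rightarrow> real) measure" where
  "green_times G = PiM G (\<lambda>_. uniform_measure lborel {0..1})"

definition arrival_time :: "nat set \<Rightarrow> (nat \<Rightarrow> real) \<Rightarrow> (nat \<Rightarrow> real) \<Rightarrow> nat \<Rightarrow> real" where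
  "arrival_time G r x e = (if e \<in> G then x e else r e)"

text \<open>
  The optimum of the single-item problem on a (nonempty finite) set of items. If several green items
  attain the largest value, \<open>g_max\<close> is an arbitrary one of them, and the others remain in
  \<open>G - {g_max v G}\<close>.
\<close>

definition OPT :: "(nat \<Rightarrow> real) \<Rightarrow> nat set \<Rightarrow> real" where
  "OPT v X = Max (v ` X)"

definition g_max :: "(nat \<Rightarrow> real) \<Rightarrow> nat set \<Rightarrow> nat" where
  "g_max v G = arg_max_on v G"

definition success_prob ::
  "'r measure \<Rightarrow> ('r \<Rightarrow> (real \<times> real) list \<Rightarrow> bool) \<Rightarrow>
     nat \<Rightarrow> nat set \<Rightarrow> (nat \<Rightarrow> real) \<Rightarrow> (nat \<Rightarrow> real) \<Rightarrow> real" where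
  "success_prob S A n G v r =
     \<P>((\<omega>, x) in S \<Otimes>\<^sub>M green_times G.
        \<exists>e. selects (A \<omega>) n v (arrival_time G r x) e \<and> v e \<ge> OPT v (G - {g_max v G}))"

end

theory Submission
  imports Defs
begin

text \<open>
  Let \<open>g'\<close> and \<open>g\<close> be the two best green items. Split \<open>[1/2, 3/4)\<close> into \<open>L = 5 k\<close> blocks of equal
  length, where \<open>n \<le> 2\<^sup>k\<close> and \<open>k = O(log n)\<close>, and call a block empty if no item other than \<open>g\<close>,
  \<open>g'\<close> of value at least \<open>v g\<close> arrives in it. The algorithm picks a random block and one of two rules.

  The sampling rule takes the first item after the block that is at least as good as everything seen in
  the block. If the block is empty, this succeeds when \<open>g\<close> lands in the block and \<open>g'\<close> in \<open>[3/4, 1]\<close>,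
  that is, with probability \<open>1 / (16 L)\<close>.

  The search rule runs a noisy binary search by multiplicative weights over the values seen before
  time \<open>1/2\<close>. Each block queries the weighted median: if the block contains an item not below
  the median, the weights of the values up to the median are halved, otherwise those of the values from
  the median on. In the chosen block the rule takes the first item not below the median. Suppose that \<open>g\<close>
  arrives before time \<open>1/2\<close>. The total weight drops by a factor \<open>3/4\<close> per block, so the weight of \<open>v g\<close>
  is halved in at least \<open>k\<close> blocks; each of those is empty or one in which taking an item not below
  the median succeeds.

  So either \<open>k / 2\<close> blocks are empty on average, and sampling succeeds with probability
  \<open>\<Omega>(1 / L)\<close>, or the search succeeds with constant probability.
\<close>

section \<open>Weighted medians and multiplicative weights\<close>

definition mass :: "('a \<Rightarrow> real) \<Rightarrow> 'a list \<Rightarrow> ('a \<Rightarrow> bool) \<Rightarrow> real" where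
  "mass w xs P = (\<Sum>x\<leftarrow>xs. if P x then w x else 0)"

text \<open>
  \<open>high w xs y\<close> and \<open>low w xs y\<close> say that \<open>y\<close> is at least, respectively at most, the
  lower weighted median of \<open>xs\<close>, without mentioning the median; this keeps measurability proofs easy.
\<close>

definition high :: "(real \<Rightarrow> real) \<Rightarrow> real list \<Rightarrow> real \<Rightarrow> bool" where
  "high w xs y \<longleftrightarrow> mass w xs (\<lambda>_. True) \<le> 2 * mass w xs (\<lambda>x. x \<le> y)"

definition low :: "(real \<Rightarrow> real) \<Rightarrow> real list \<Rightarrow> real \<Rightarrow> bool" where
  "low w xs y \<longleftrightarrow> mass w xs (\<lambda>_. True) < 2 * mass w xs (\<lambda>x. y \<le> x)"

text \<open>The case split makes either answer of a block useful when it refutes \<open>y\<close>: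
  either the block has a high item, and every high item is at least \<open>y\<close> because
  \<open>y\<close> is low, or no item of the block is high although \<open>y\<close> is, so the
  block has no item of value at least \<open>y\<close>.\<close>

definition refuted :: "(real \<Rightarrow> real) \<Rightarrow> real list \<Rightarrow> real list \<Rightarrow> real \<Rightarrow> bool" where
  "refuted w xs zs y \<longleftrightarrow> (if \<exists>z\<in>set zs. high w xs z then low w xs y else high w xs y)"

text \<open>\<open>obs 0\<close> plays the candidate values seen before time 1/2, and
  \<open>obs (Suc i)\<close> the values of the block that is queried with the weights of stage
  \<open>i\<close>.\<close>

primrec weight :: "(nat \<Rightarrow> real list) \<Rightarrow> nat \<Rightarrow> real \<Rightarrow> real" where
  "weight obs 0 = (\<lambda>_. 1)"
| "weight obs (Suc i) =
     (\<lambda>y. if refuted (weight obs i) (obs 0) (obs (Suc i)) y then weight obs i y / 2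
          else weight obs i y)"

lemma mass_mono:
  assumes "\<And>x. x \<in> set xs \<Longrightarrow> 0 \<le> w x" "\<And>x. x \<in> set xs \<Longrightarrow> P x \<Longrightarrow> Q x"
  shows "mass w xs P \<le> mass w xs Q"
  unfolding mass_def by (rule sum_list_mono) (use assms in auto)

lemma mass_False [simp]: "mass w xs (\<lambda>_. False) = 0"
  by (simp add: mass_def)

lemma mass_add_mass_not: "mass w xs P + mass w xs (\<lambda>x. \<not> P x) = mass w xs (\<lambda>_. True)"
  unfolding mass_def sum_list_addf[symmetric] by (rule arg_cong[of _ _ sum_list]) auto

lemma mass_halve:
  "mass (\<lambda>y. if P y then w y / 2 else w y) xs (\<lambda>_. True) =
     mass w xs (\<lambda>_. True) - mass w xs P / 2"
  by (induction xs) (auto simp: mass_def field_simps)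

text \<open>The entries that are not high lie at or below the largest of them, and less than half of
  the mass lies at or below that one. The case of \<open>low\<close> is the mirror image with the
  least such entry.\<close>

lemma mass_high:
  assumes w: "\<And>x. 0 \<le> w x"
  shows "mass w xs (\<lambda>_. True) \<le> 2 * mass w xs (high w xs)"
proof -
  let ?N = "{x \<in> set xs. \<not> high w xs x}"
  have "2 * mass w xs (\<lambda>x. \<not> high w xs x) \<le> mass w xs (\<lambda>_. True)"
  proof (cases "?N = {}")
    case True
    then have "mass w xs (\<lambda>x. \<not> high w xs x) \<le> mass w xs (\<lambda>_. False)"
      using w by (intro mass_mono) auto
    moreover have "mass w xs (\<lambda>_. False) \<le> mass w xs (\<lambda>_. True)"
      using w by (intro mass_mono) auto
    ultimately show ?thesis by simp
  next
    case False
    define y where "y = Max ?N"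
    have "y \<in> ?N" unfolding y_def by (rule Max_in) (use False in auto)
    then have "2 * mass w xs (\<lambda>x. x \<le> y) < mass w xs (\<lambda>_. True)"
      by (simp add: high_def)
    moreover have "mass w xs (\<lambda>x. \<not> high w xs x) \<le> mass w xs (\<lambda>x. x \<le> y)"
      using w by (intro mass_mono) (auto simp: y_def intro: Max_ge)
    ultimately show ?thesis by linarith
  qed
  then show ?thesis using mass_add_mass_not[of w xs "high w xs"] by linarith
qed

lemma mass_low:
  assumes w: "\<And>x. 0 \<le> w x"
  shows "mass w xs (\<lambda>_. True) \<le> 2 * mass w xs (low w xs)"
proof -
  let ?N = "{x \<in> set xs. \<not> low w xs x}"
  have "2 * mass w xs (\<lambda>x. \<not> low w xs x) \<le> mass w xs (\<lambda>_. True)"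
  proof (cases "?N = {}")
    case True
    then have "mass w xs (\<lambda>x. \<not> low w xs x) \<le> mass w xs (\<lambda>_. False)"
      using w by (intro mass_mono) auto
    moreover have "mass w xs (\<lambda>_. False) \<le> mass w xs (\<lambda>_. True)"
      using w by (intro mass_mono) auto
    ultimately show ?thesis by simp
  next
    case False
    define y where "y = Min ?N"
    have "y \<in> ?N" unfolding y_def by (rule Min_in) (use False in auto)
    then have "2 * mass w xs (\<lambda>x. y \<le> x) \<le> mass w xs (\<lambda>_. True)"
      by (simp add: low_def)
    moreover have "mass w xs (\<lambda>x. \<not> low w xs x) \<le> mass w xs (\<lambda>x. y \<le> x)"
      using w by (intro mass_mono) (auto simp: y_def intro: Min_le)
    ultimately show ?thesis by linarith
  qed
  then show ?thesis using mass_add_mass_not[of w xs "low w xs"] by linarith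
qed

text \<open>If \<open>z < y\<close>, the entries from \<open>y\<close> on and those up to
  \<open>z\<close> are disjoint, yet the former carry more than half of the mass and the latter at
  least half.\<close>

lemma low_le_high:
  assumes w: "\<And>x. 0 \<le> w x" and "low w xs y" "high w xs z"
  shows "y \<le> z"
proof (rule ccontr)
  assume "\<not> y \<le> z"
  then have "mass w xs (\<lambda>x. y \<le> x) \<le> mass w xs (\<lambda>x. \<not> x \<le> z)"
    using w by (intro mass_mono) auto
  then show False
    using assms(2,3) mass_add_mass_not[of w xs "\<lambda>x. x \<le> z"] by (simp add: low_def high_def)
qed

lemma high_mono:
  assumes w: "\<And>x. 0 \<le> w x" and "high w xs y" "y \<le> z"
  shows "high w xs z"
proof -
  have "mass w xs (\<lambda>x. x \<le> y) \<le> mass w xs (\<lambda>x. x \<le> z)"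
    using w assms(3) by (intro mass_mono) auto
  then show ?thesis using assms(2) by (simp add: high_def)
qed

lemma weight_nonneg: "0 \<le> weight obs i y"
  by (induction i arbitrary: y) auto

text \<open>This makes the search rule online: the weights of stage \<open>i\<close> are known once
  block \<open>i\<close> is over.\<close>

lemma weight_cong:
  assumes "\<And>j. j \<le> i \<Longrightarrow> obs j = obs' j"
  shows "weight obs i = weight obs' i"
  using assms by (induction i) auto

lemma weight_eq_power:
  "weight obs i y =
     (1 / 2) ^ card {j. j < i \<and> refuted (weight obs j) (obs 0) (obs (Suc j)) y}"
proof (induction i)
  case (Suc i)
  let ?R = "\<lambda>j. refuted (weight obs j) (obs 0) (obs (Suc j)) y"
  have "{j. j < Suc i \<and> ?R j} = (if ?R i then insert i {j. j < i \<and> ?R j} else {j. j < i \<and> ?R j})"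
    by (auto simp: less_Suc_eq)
  then show ?case using Suc by simp
qed simp

text \<open>Whichever side of the median is refuted carries at least half of the mass, so halving it
  removes at least a quarter.\<close>

lemma mass_weight_Suc_le:
  "mass (weight obs (Suc i)) (obs 0) (\<lambda>_. True) \<le> 3 / 4 * mass (weight obs i) (obs 0) (\<lambda>_. True)"
proof -
  let ?w = "weight obs i" and ?xs = "obs 0"
  have "mass ?w ?xs (\<lambda>_. True) \<le> 2 * mass ?w ?xs (refuted ?w ?xs (obs (Suc i)))"
    using mass_low[of ?w ?xs] mass_high[of ?w ?xs] weight_nonneg
    by (cases "\<exists>z\<in>set (obs (Suc i)). high ?w ?xs z") (simp_all add: refuted_def[abs_def])
  then show ?thesis by (simp add: mass_halve)
qed

lemma mass_weight_le: "mass (weight obs i) (obs 0) (\<lambda>_. True) \<le> (3 / 4) ^ i * length (obs 0)"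
proof (induction i)
  case 0
  show ?case by (simp add: mass_def sum_list_triv)
next
  case (Suc i)
  then show ?case using mass_weight_Suc_le[of obs i] by simp
qed

text \<open>The weight of \<open>y\<close> is exactly (1/2)^c after c refutations, and it is at most
  the total mass, which decays geometrically.\<close>

lemma card_refuted_ge:
  assumes y: "y \<in> set (obs 0)" and len: "length (obs 0) \<le> 2 ^ k"
  shows "k \<le> card {j. j < 5 * k \<and> refuted (weight obs j) (obs 0) (obs (Suc j)) y}" (is "k \<le> ?c")
proof -
  let ?w = "weight obs (5 * k)"
  have "?w y \<le> mass ?w (obs 0) (\<lambda>_. True)"
    unfolding mass_def using y weight_nonneg[of obs "5 * k"]
    by (auto intro!: member_le_sum_list)
  also have "\<dots> \<le> (3 / 4) ^ (5 * k) * length (obs 0)"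
    by (rule mass_weight_le)
  also have "\<dots> \<le> (3 / 4) ^ (5 * k) * 2 ^ k"
  proof -
    have "real (length (obs 0)) \<le> 2 ^ k"
      using len by (metis of_nat_le_iff of_nat_numeral of_nat_power)
    then show ?thesis by (intro mult_left_mono) auto
  qed
  also have "\<dots> = ((3 / 4) ^ 5 * 2) ^ k"
    by (simp only: power_mult power_mult_distrib)
  \<comment> \<open>The factor 5 in the number of blocks comes from here: 2 * (3/4)^5 = 486/1024 is
    below 1/2, while the exponent 4 would be too small.\<close>
  also have "\<dots> \<le> (1 / 2) ^ k"
    by (rule power_mono) (auto simp: eval_nat_numeral)
  finally have "(1 / 2 :: real) ^ ?c \<le> (1 / 2) ^ k"
    by (simp only: weight_eq_power)
  then show ?thesis
    by (subst (asm) power_decreasing_iff) auto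
qed

section \<open>Blocks of time and the two rules\<close>

definition block :: "nat \<Rightarrow> real \<Rightarrow> nat" where
  "block L t = nat \<lfloor>4 * real L * (t - 1 / 2) + 1\<rfloor>"

text \<open>
  Block \<open>0\<close> is \<open>[0, 1/2)\<close> since \<^const>\<open>nat\<close> truncates; blocks \<open>1, ..., L\<close> partition \<open>[1/2, 3/4)\<close>.
\<close>

definition block_values :: "nat \<Rightarrow> (real \<times> real) list \<Rightarrow> nat \<Rightarrow> real list" where
  "block_values L h b = map snd (filter (\<lambda>p. block L (fst p) = b) h)"

definition search_rule :: "nat \<Rightarrow> nat \<Rightarrow> (real \<times> real) list \<Rightarrow> bool" where
  "search_rule L i h \<longleftrightarrow> h \<noteq> [] \<and> block L (fst (last h)) = Suc i \<and>
     high (weight (block_values L h) i) (block_values L h 0) (snd (last h))"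

definition sample_rule :: "nat \<Rightarrow> nat \<Rightarrow> (real \<times> real) list \<Rightarrow> bool" where
  "sample_rule L i h \<longleftrightarrow> h \<noteq> [] \<and> block L (fst (last h)) > Suc i \<and>
     (\<forall>z\<in>set (block_values L h (Suc i)). z \<le> snd (last h))"

lemma block_mono: "s \<le> t \<Longrightarrow> block L s \<le> block L t"
  unfolding block_def by (intro nat_mono floor_mono add_right_mono mult_left_mono) auto

lemma block_eq_0_iff:
  assumes "L > 0"
  shows "block L t = 0 \<longleftrightarrow> t < 1 / 2"
proof -
  have "block L t = 0 \<longleftrightarrow> \<lfloor>4 * real L * (t - 1 / 2) + 1\<rfloor> < 1"
    unfolding block_def by linarith
  also have "\<dots> \<longleftrightarrow> real L * (t - 1 / 2) < 0"
    by (subst floor_less_iff) auto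
  also have "\<dots> \<longleftrightarrow> t < 1 / 2"
    using assms by (simp add: mult_less_0_iff)
  finally show ?thesis .
qed

lemma block_eq_Suc_iff:
  assumes "L > 0"
  shows "block L t = Suc i \<longleftrightarrow> 1 / 2 + i / (4 * real L) \<le> t \<and> t < 1 / 2 + Suc i / (4 * real L)"
proof -
  have "block L t = Suc i \<longleftrightarrow> \<lfloor>4 * real L * (t - 1 / 2) + 1\<rfloor> = 1 + int i"
    unfolding block_def by linarith
  also have "\<dots> \<longleftrightarrow> i \<le> 4 * real L * (t - 1 / 2) \<and> 4 * real L * (t - 1 / 2) < Suc i"
    by (simp add: floor_eq_iff) linarith
  also have "\<dots> \<longleftrightarrow> 1 / 2 + i / (4 * real L) \<le> t \<and> t < 1 / 2 + Suc i / (4 * real L)"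
    using assms pos_divide_le_eq[of "4 * real L" i "t - 1 / 2"]
      pos_less_divide_eq[of "4 * real L" "t - 1 / 2" "Suc i"]
    by (simp add: mult.commute) linarith
  finally show ?thesis .
qed

lemma block_gt_iff:
  assumes "L > 0"
  shows "L < block L t \<longleftrightarrow> 3 / 4 \<le> t"
proof -
  have "L < block L t \<longleftrightarrow> int (Suc L) \<le> \<lfloor>4 * real L * (t - 1 / 2) + 1\<rfloor>"
    unfolding block_def by linarith
  also have "\<dots> \<longleftrightarrow> real L \<le> 4 * real L * (t - 1 / 2)"
    by (subst le_floor_iff) simp
  also have "\<dots> \<longleftrightarrow> 3 / 4 \<le> t"
    using assms by (simp add: field_simps)
  finally show ?thesis .
qed

section \<open>Arrival order, histories and deterministic success of the rules\<close>

lemma set_arrival_order [simp]: "set (arrival_order n t) = {..<n}"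
  by (auto simp: arrival_order_def)

lemma length_arrival_order [simp]: "length (arrival_order n t) = n"
  by (simp add: arrival_order_def)

lemma arrival_order_mono:
  "i \<le> j \<Longrightarrow> j < n \<Longrightarrow> t (arrival_order n t ! i) \<le> t (arrival_order n t ! j)"
  using sorted_nth_mono[of "map t (arrival_order n t)" i j] by (simp add: arrival_order_def)

lemma ex_arrival_order_nth: "e < n \<Longrightarrow> \<exists>j<n. arrival_order n t ! j = e"
  using in_set_conv_nth[of e "arrival_order n t"] by simp

text \<open>The selected item is the first accepted one. If every accepted item is good, it suffices
  to exhibit any accepting step, without knowing which one is first.\<close>

lemma ex_selects:
  assumes "j < n" "D (history n v t (Suc j))"
    and "\<And>j. j < n \<Longrightarrow> D (history n v t (Suc j)) \<Longrightarrow> b \<le> v (arrival_order n t ! j)"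
  shows "\<exists>e. selects D n v t e \<and> b \<le> v e"
proof -
  define m where "m = (LEAST j. j < n \<and> D (history n v t (Suc j)))"
  have m: "m < n \<and> D (history n v t (Suc m))"
    unfolding m_def by (rule LeastI[of _ j]) (use assms in auto)
  have "\<not> D (history n v t (Suc i))" if "i < m" for i
    using not_less_Least[of i "\<lambda>j. j < n \<and> D (history n v t (Suc j))"] that m
    by (auto simp: m_def)
  then have "selects D n v t (arrival_order n t ! m)"
    unfolding selects_def using m by blast
  then show ?thesis using m assms(3) by blast
qed

lemma last_history:
  "j < n \<Longrightarrow> history n v t (Suc j) \<noteq> [] \<and>
     last (history n v t (Suc j)) = (t (arrival_order n t ! j), v (arrival_order n t ! j))"
  by (simp add: history_def take_Suc_conv_app_nth)

lemma block_values_history: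
  "block_values L (history n v t k) b =
     map v (filter (\<lambda>e. block L (t e) = b) (take k (arrival_order n t)))"
  by (simp add: block_values_def history_def filter_map comp_def)

lemma set_block_values_history:
  "set (block_values L (history n v t n) b) = v ` {e. e < n \<and> block L (t e) = b}"
  by (auto simp: block_values_history)

text \<open>Times do not decrease along the arrival order and \<open>block\<close> is monotone, so
  nothing more can arrive in block \<open>b\<close> after an item of a later block. The prefix can
  thus be replaced by the full history in the analysis.\<close>

lemma block_values_history_Suc:
  assumes "j < n" "b < block L (t (arrival_order n t ! j))"
  shows "block_values L (history n v t (Suc j)) b = block_values L (history n v t n) b"
proof -
  let ?xs = "arrival_order n t"
  have "block L (t e) \<noteq> b" if e: "e \<in> set (drop (Suc j) ?xs)" for e
  proof -
    obtain m where m: "m < n - Suc j" "e = ?xs ! (Suc j + m)"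
      using e assms(1) by (auto simp: in_set_conv_nth)
    then have "t (?xs ! j) \<le> t e"
      by (auto intro!: arrival_order_mono)
    then show ?thesis using assms(2) block_mono[of "t (?xs ! j)" "t e" L] by linarith
  qed
  then have "filter (\<lambda>e. block L (t e) = b) (drop (Suc j) ?xs) = []"
    by (simp add: filter_empty_conv)
  then have "filter (\<lambda>e. block L (t e) = b) (take (Suc j) ?xs) = filter (\<lambda>e. block L (t e) = b) ?xs"
    by (metis append_Nil2 append_take_drop_id filter_append)
  then show ?thesis by (simp add: block_values_history)
qed

text \<open>Throughout block \<open>Suc i\<close> the rule tests against one fixed threshold, since
  the blocks up to \<open>i\<close> that determine it are over.\<close>

lemma search_rule_history:
  assumes "j < n"
  shows "search_rule L i (history n v t (Suc j)) \<longleftrightarrow>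
    block L (t (arrival_order n t ! j)) = Suc i \<and>
    high (weight (block_values L (history n v t n)) i) (block_values L (history n v t n) 0)
      (v (arrival_order n t ! j))"
proof (cases "block L (t (arrival_order n t ! j)) = Suc i")
  case True
  then have "block_values L (history n v t (Suc j)) b = block_values L (history n v t n) b"
    if "b \<le> i" for b
    using that assms by (intro block_values_history_Suc) auto
  then show ?thesis
    using True last_history[OF assms]
      weight_cong[of i "block_values L (history n v t (Suc j))" "block_values L (history n v t n)"]
    by (simp add: search_rule_def)
qed (use last_history[OF assms] in \<open>auto simp: search_rule_def\<close>)

lemma sample_rule_history:
  assumes "j < n"
  shows "sample_rule L i (history n v t (Suc j)) \<longleftrightarrow>
    Suc i < block L (t (arrival_order n t ! j)) \<and>
    (\<forall>e<n. block L (t e) = Suc i \<longrightarrow> v e \<le> v (arrival_order n t ! j))"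
  using last_history[OF assms] block_values_history_Suc[OF assms, of "Suc i" L t v]
  by (auto simp: sample_rule_def set_block_values_history)

text \<open>The item \<open>g\<close> is the best of its block, so every accepted item is worth at
  least \<open>b\<close>; and the later \<open>g'\<close> would be accepted.\<close>

lemma sample_rule_succeeds:
  assumes g: "g < n" "block L (t g) = Suc i" "v g = b"
    and g': "g' < n" "Suc i < block L (t g')" "b \<le> v g'"
    and others: "\<And>e. e < n \<Longrightarrow> e \<noteq> g \<Longrightarrow> block L (t e) = Suc i \<Longrightarrow> v e < b"
  shows "\<exists>e. selects (sample_rule L i) n v t e \<and> b \<le> v e"
proof -
  obtain j where "j < n" "arrival_order n t ! j = g'"
    using ex_arrival_order_nth[OF g'(1)] by blast
  moreover have "v e \<le> v g'" if "e < n" "block L (t e) = Suc i" for e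
    using others[OF that(1) _ that(2)] g g' by (cases "e = g") auto
  ultimately show ?thesis
    using g g' by (intro ex_selects[of j]) (auto simp: sample_rule_history)
qed

text \<open>The item \<open>e\<close> excludes the branch of \<open>refuted\<close> without high
  items: there \<open>b\<close> would be high, and so would \<open>v e\<close>. Hence some item of
  the block is high, \<open>b\<close> is low, and every accepted item is at least
  \<open>b\<close>.\<close>

lemma search_rule_succeeds:
  fixes n L v t
  defines "obs \<equiv> block_values L (history n v t n)"
  assumes ref: "refuted (weight obs i) (obs 0) (obs (Suc i)) b"
    and e: "e < n" "block L (t e) = Suc i" "b \<le> v e"
  shows "\<exists>e. selects (search_rule L i) n v t e \<and> b \<le> v e"
proof -
  let ?H = "high (weight obs i) (obs 0)"
  have obs: "set (obs (Suc i)) = v ` {e. e < n \<and> block L (t e) = Suc i}"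
    by (simp add: obs_def set_block_values_history)
  have ex: "\<exists>z\<in>set (obs (Suc i)). ?H z"
  proof (rule ccontr)
    assume none: "\<not> ?thesis"
    then have "?H b" using ref by (simp add: refuted_def)
    then have "?H (v e)" using e(3) high_mono weight_nonneg by blast
    then show False using none obs e by blast
  qed
  then have low: "low (weight obs i) (obs 0) b"
    using ref by (simp add: refuted_def)
  obtain a where a: "a < n" "block L (t a) = Suc i" "?H (v a)"
    using ex obs by auto
  obtain j where "j < n" "arrival_order n t ! j = a"
    using ex_arrival_order_nth[OF a(1)] by blast
  then show ?thesis
    using a low weight_nonneg
    by (intro ex_selects[of j]) (auto simp: search_rule_history obs_def intro: low_le_high)
qed

lemma card_search_rule_succeeds_ge:
  assumes g: "g < n" "block L (t g) = 0" and n: "n \<le> 2 ^ k" and L: "L = 5 * k"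
  shows "k \<le> card {i. i < L \<and> (\<exists>e. selects (search_rule L i) n v t e \<and> v g \<le> v e)} +
             card {i. i < L \<and> (\<forall>e<n. v g \<le> v e \<longrightarrow> block L (t e) \<noteq> Suc i)}"
    (is "_ \<le> card ?A + card ?B")
proof -
  define obs where "obs = block_values L (history n v t n)"
  let ?R = "{i. i < 5 * k \<and> refuted (weight obs i) (obs 0) (obs (Suc i)) (v g)}"
  have "v g \<in> set (obs 0)"
    using g by (auto simp: obs_def set_block_values_history)
  moreover have "length (obs 0) \<le> n"
    using length_filter_le[of _ "arrival_order n t"] by (simp add: obs_def block_values_history)
  ultimately have "k \<le> card ?R"
    using n by (intro card_refuted_ge) auto
  also have "?R \<subseteq> ?A \<union> ?B"
    using search_rule_succeeds L unfolding obs_def by blast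
  then have "card ?R \<le> card (?A \<union> ?B)"
    by (intro card_mono) auto
  also have "\<dots> \<le> card ?A + card ?B"
    by (rule card_Un_le)
  finally show ?thesis .
qed

section \<open>Measurability of the two rules\<close>

text \<open>The length of the filtered list depends on the sample point; a sum over the fixed
  positions below \<open>k\<close> avoids this and is measurable termwise.\<close>

lemma mass_block_values:
  "mass w (block_values L (map f [0..<k]) b) P =
     (\<Sum>p<k. if block L (fst (f p)) = b \<and> P (snd (f p)) then w (snd (f p)) else 0)"
  by (auto simp: mass_def block_values_def filter_map comp_def sum_list_map_filter'
      interv_sum_list_conv_sum_set_nat atLeast0LessThan intro!: sum.cong)

lemma bex_block_values:
  "(\<exists>z\<in>set (block_values L (map f [0..<k]) b). P z) \<longleftrightarrow>
     (\<exists>p<k. block L (fst (f p)) = b \<and> P (snd (f p)))"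
  by (auto simp: block_values_def)

lemma ball_block_values:
  "(\<forall>z\<in>set (block_values L (map f [0..<k]) b). P z) \<longleftrightarrow>
     (\<forall>p<k. block L (fst (f p)) = b \<longrightarrow> P (snd (f p)))"
  using bex_block_values[of L f k b "\<lambda>z. \<not> P z"] by blast

lemma measurable_block [measurable]: "block L \<in> measurable borel (count_space UNIV)"
  unfolding block_def by measurable

context
  fixes M :: "'a measure" and T V :: "nat \<Rightarrow> 'a \<Rightarrow> real"
  assumes T [measurable]: "\<And>p. T p \<in> borel_measurable M"
    and V [measurable]: "\<And>p. V p \<in> borel_measurable M"
begin

text \<open>Both \<open>w\<close> and \<open>Q\<close> may depend on the sample point. They are only
  ever evaluated at observed values, so measurability along each \<open>V p\<close> is what is
  assumed.\<close>

lemma measurable_mass: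
  assumes w: "\<And>p. (\<lambda>x. w x (V p x)) \<in> borel_measurable M"
    and Q: "\<And>p. Measurable.pred M (\<lambda>x. Q x (V p x))"
  shows "(\<lambda>x. mass (w x) (block_values L (map (\<lambda>p. (T p x, V p x)) [0..<k]) b) (Q x))
    \<in> borel_measurable M"
  unfolding mass_block_values fst_conv snd_conv
proof (intro borel_measurable_sum)
  fix p
  note [measurable] = w[of p] Q[of p]
  show "(\<lambda>x. if block L (T p x) = b \<and> Q x (V p x) then w x (V p x) else 0) \<in> borel_measurable M"
    by measurable
qed

lemma measurable_high:
  assumes w: "\<And>p. (\<lambda>x. w x (V p x)) \<in> borel_measurable M"
    and [measurable]: "Y \<in> borel_measurable M"
  shows "Measurable.pred M
    (\<lambda>x. high (w x) (block_values L (map (\<lambda>p. (T p x, V p x)) [0..<k]) b) (Y x))"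
  unfolding high_def pred_def
  by (intro borel_measurable_le borel_measurable_times borel_measurable_const
      measurable_mass w) measurable

lemma measurable_low:
  assumes w: "\<And>p. (\<lambda>x. w x (V p x)) \<in> borel_measurable M"
    and [measurable]: "Y \<in> borel_measurable M"
  shows "Measurable.pred M
    (\<lambda>x. low (w x) (block_values L (map (\<lambda>p. (T p x, V p x)) [0..<k]) b) (Y x))"
  unfolding low_def
  by (intro borel_measurable_pred_less borel_measurable_times borel_measurable_const
      measurable_mass w) measurable

text \<open>The induction is over all measurable \<open>Y\<close>, since the recursion evaluates the
  previous weights at the query point and also at the observed values \<open>V p\<close>.\<close>

lemma measurable_weight:
  assumes "Y \<in> borel_measurable M"
  shows "(\<lambda>x. weight (block_values L (map (\<lambda>p. (T p x, V p x)) [0..<k])) i (Y x))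
    \<in> borel_measurable M"
  using assms
proof (induction i arbitrary: Y)
  case (Suc i)
  note [measurable] = Suc.prems Suc.IH
  let ?w = "\<lambda>x. weight (block_values L (map (\<lambda>p. (T p x, V p x)) [0..<k])) i"
  note [measurable] =
    measurable_high[where w = ?w, OF Suc.IH[OF V]] measurable_low[where w = ?w, OF Suc.IH[OF V]]
  show ?case
    unfolding weight.simps refuted_def bex_block_values fst_conv snd_conv by measurable
qed simp

lemma measurable_search_rule:
  "Measurable.pred M (\<lambda>x. search_rule L i (map (\<lambda>p. (T p x, V p x)) [0..<k]))"
proof (cases k)
  case (Suc m)
  let ?w = "\<lambda>x. weight (block_values L (map (\<lambda>p. (T p x, V p x)) [0..<k])) i"
  note [measurable] = measurable_high[where w = ?w, OF measurable_weight[OF V]]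
  have "search_rule L i (map (\<lambda>p. (T p x, V p x)) [0..<k]) \<longleftrightarrow> block L (T m x) = Suc i \<and>
      high (?w x) (block_values L (map (\<lambda>p. (T p x, V p x)) [0..<k]) 0) (V m x)" for x
    unfolding search_rule_def using Suc by (simp add: last_map)
  then show ?thesis by simp
qed (simp add: search_rule_def)

lemma measurable_sample_rule:
  "Measurable.pred M (\<lambda>x. sample_rule L i (map (\<lambda>p. (T p x, V p x)) [0..<k]))"
proof (cases k)
  case (Suc m)
  then show ?thesis
    unfolding sample_rule_def ball_block_values by (simp add: last_map del: upt_Suc)
qed (simp add: sample_rule_def)

end

section \<open>The randomized algorithm and measurability of its selection\<close>

text \<open>Seeds below \<open>L\<close> choose the search rule, the others the sampling rule.\<close>

definition byzantine_rule :: "nat \<Rightarrow> real \<Rightarrow> (real \<times> real) list \<Rightarrow> bool" where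
  "byzantine_rule L \<omega> h =
     (let i = nat \<lfloor>\<omega>\<rfloor> in if i < L then search_rule L i h else sample_rule L (i - L) h)"

definition byzantine_seed :: "nat \<Rightarrow> real measure" where
  "byzantine_seed L = uniform_count_measure (real ` {..<2 * L})"

lemma online_algorithm_byzantine:
  assumes "L > 0"
  shows "online_algorithm (byzantine_seed L) (byzantine_rule L)"
  unfolding online_algorithm_def
proof (intro conjI allI)
  show "prob_space (byzantine_seed L)"
    unfolding byzantine_seed_def
    by (rule prob_space_uniform_count_measure) (use assms in \<open>auto simp: lessThan_empty_iff\<close>)
  fix k
  let ?N = "PiM {..<k} (\<lambda>_. borel) :: (nat \<Rightarrow> real \<times> real) measure"
  \<comment> \<open>Measurability of the rules was shown for sequences with measurable entries at
    every index, but the product has only the coordinates below \<open>k\<close>; the rest is padded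
    with 0.\<close>
  define T V :: "nat \<Rightarrow> (nat \<Rightarrow> real \<times> real) \<Rightarrow> real"
    where "T = (\<lambda>p x. if p < k then fst (x p) else 0)"
      and "V = (\<lambda>p x. if p < k then snd (x p) else 0)"
  have proj: "(\<lambda>x. x p) \<in> measurable ?N (borel \<Otimes>\<^sub>M borel)" if "p < k" for p
    unfolding borel_prod using that by (intro measurable_component_singleton) simp
  have [measurable]: "T p \<in> borel_measurable ?N" "V p \<in> borel_measurable ?N" for p
    using measurable_compose[OF proj measurable_fst] measurable_compose[OF proj measurable_snd]
    by (cases "p < k"; simp add: T_def V_def)+
  have map_eq: "map (\<lambda>p. (T p x, V p x)) [0..<k] = map x [0..<k]" for x
    by (auto simp: T_def V_def)
  have "Measurable.pred ?N (\<lambda>x. search_rule L i (map x [0..<k]))"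
    "Measurable.pred ?N (\<lambda>x. sample_rule L i (map x [0..<k]))" for i
    using measurable_search_rule[of T ?N V L i k] measurable_sample_rule[of T ?N V L i k]
    by (simp_all add: map_eq)
  then have "Measurable.pred ?N (\<lambda>x. byzantine_rule L \<omega> (map x [0..<k]))" for \<omega>
    by (simp add: byzantine_rule_def Let_def)
  \<comment> \<open>As there are finitely many seeds, measurability for each fixed seed gives joint
    measurability.\<close>
  then have rule: "(\<lambda>(\<omega>, x). byzantine_rule L \<omega> (map x [0..<k]))
      \<in> measurable (count_space (real ` {..<2 * L}) \<Otimes>\<^sub>M ?N) (count_space UNIV)"
    by (intro measurable_pair_measure_countable1) auto
  have sets_eq: "sets (count_space (real ` {..<2 * L}) \<Otimes>\<^sub>M ?N) = sets (byzantine_seed L \<Otimes>\<^sub>M ?N)"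
    by (intro sets_pair_measure_cong) (auto simp: byzantine_seed_def sets_uniform_count_measure)
  show "(\<lambda>(\<omega>, x). byzantine_rule L \<omega> (map x [0..<k]))
      \<in> measurable (byzantine_seed L \<Otimes>\<^sub>M ?N) (count_space UNIV)"
    using rule unfolding measurable_cong_sets[OF sets_eq refl] .
qed

lemma measurable_insort_key:
  assumes [measurable]: "\<And>e. t e \<in> borel_measurable M"
  shows "(\<lambda>x. insort_key (\<lambda>e. t e x :: real) a l) \<in> measurable M (count_space UNIV)"
proof (induction l)
  case (Cons b l)
  have [measurable]: "(\<lambda>x. b # insort_key (\<lambda>e. t e x) a l) \<in> measurable M (count_space UNIV)"
    by (rule measurable_compose[OF Cons]) simp
  show ?case by simp
qed simp

lemma measurable_arrival_order:
  assumes t: "\<And>e. t e \<in> borel_measurable M"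
  shows "(\<lambda>x. arrival_order n (\<lambda>e. t e x)) \<in> measurable M (count_space UNIV)"
proof -
  have "(\<lambda>x. sort_key (\<lambda>e. t e x) l) \<in> measurable M (count_space UNIV)" for l :: "nat list"
  proof (induction l)
    case (Cons a l)
    then show ?case
      using measurable_compose_countable[OF measurable_insort_key[OF t] Cons] by simp
  qed simp
  then show ?thesis by (simp add: arrival_order_def)
qed

text \<open>There are only countably many possible arrival orders. For a fixed order
  \<open>l\<close> the decisions \<open>D l\<close> are measurable by the definition of an online
  algorithm, and the random order is then substituted for \<open>l\<close>.\<close>

lemma measurable_selects:
  assumes A: "online_algorithm S A" and t: "\<And>e. t e \<in> borel_measurable M"
  shows "Measurable.pred (S \<Otimes>\<^sub>M M)
    (\<lambda>(\<omega>, x). \<exists>e. selects (A \<omega>) n v (\<lambda>e. t e x) e \<and> P e)"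
proof -
  define D where "D l z \<longleftrightarrow> A (fst z) (map (\<lambda>e. (t e (snd z), v e)) l)" for l z
  have D [measurable]: "Measurable.pred (S \<Otimes>\<^sub>M M) (D l)" for l
  proof -
    define f where "f z = (fst z, \<lambda>p\<in>{..<length l}. (t (l ! p) (snd z), v (l ! p)))" for z :: "'a \<times> 'b"
    have [measurable]: "(\<lambda>z. t e (snd z)) \<in> borel_measurable (S \<Otimes>\<^sub>M M)" for e
      by (rule measurable_compose[OF measurable_snd t])
    have "f \<in> measurable (S \<Otimes>\<^sub>M M) (S \<Otimes>\<^sub>M PiM {..<length l} (\<lambda>_. borel))"
      unfolding f_def by (intro measurable_Pair measurable_restrict) (simp_all flip: borel_prod)
    moreover have "(\<lambda>(\<omega>, x). A \<omega> (map x [0..<length l])) \<in>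
        measurable (S \<Otimes>\<^sub>M PiM {..<length l} (\<lambda>_. borel)) (count_space UNIV)"
      using A unfolding online_algorithm_def by blast
    ultimately have "(\<lambda>z. (\<lambda>(\<omega>, x). A \<omega> (map x [0..<length l])) (f z))
        \<in> measurable (S \<Otimes>\<^sub>M M) (count_space UNIV)"
      by (rule measurable_compose)
    moreover have "map (\<lambda>p\<in>{..<length l}. (t (l ! p) x, v (l ! p))) [0..<length l] =
        map (\<lambda>e. (t e x, v e)) l" for x
      by (rule nth_equalityI) auto
    ultimately show ?thesis by (simp add: f_def D_def[abs_def])
  qed
  define s where "s l z \<longleftrightarrow>
    (\<exists>i<n. D (take (Suc i) l) z \<and> (\<forall>j<i. \<not> D (take (Suc j) l) z) \<and> P (l ! i))" for l z
  have "Measurable.pred (S \<Otimes>\<^sub>M M) (s l)" for l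
    unfolding s_def by measurable
  moreover have "(\<lambda>z. arrival_order n (\<lambda>e. t e (snd z))) \<in> measurable (S \<Otimes>\<^sub>M M) (count_space UNIV)"
    by (rule measurable_arrival_order) (rule measurable_compose[OF measurable_snd t])
  ultimately have "Measurable.pred (S \<Otimes>\<^sub>M M) (\<lambda>z. s (arrival_order n (\<lambda>e. t e (snd z))) z)"
    by (rule measurable_compose_countable)
  moreover have "(\<lambda>(\<omega>, x). \<exists>e. selects (A \<omega>) n v (\<lambda>e. t e x) e \<and> P e) =
      (\<lambda>z. s (arrival_order n (\<lambda>e. t e (snd z))) z)"
  proof (rule ext, clarify)
    fix \<omega> x
    show "(\<exists>e. selects (A \<omega>) n v (\<lambda>e. t e x) e \<and> P e) =
        s (arrival_order n (\<lambda>e. t e (snd (\<omega>, x)))) (\<omega>, x)"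
      unfolding selects_def s_def D_def history_def fst_conv snd_conv by blast
  qed
  ultimately show ?thesis by (simp only:)
qed

section \<open>Distribution of the green arrival times\<close>

abbreviation uniform01 :: "real measure" where
  "uniform01 \<equiv> uniform_measure lborel {0..1}"

lemma measure_uniform01:
  "A \<in> sets borel \<Longrightarrow> measure uniform01 A = measure lborel ({0..1} \<inter> A)"
  by (subst measure_uniform_measure) auto

lemma prob_space_uniform01: "prob_space uniform01"
  by (rule prob_space_uniform_measure) auto

lemma prob_block_eq_0: "L > 0 \<Longrightarrow> measure uniform01 {t. block L t = 0} = 1 / 2"
proof -
  assume "L > 0"
  then have "{0..1} \<inter> {t. block L t = 0} = {0..<1 / 2}"
    by (auto simp: block_eq_0_iff)
  then show ?thesis by (subst measure_uniform01) auto
qed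

lemma prob_block_eq_Suc: "i < L \<Longrightarrow> measure uniform01 {t. block L t = Suc i} = 1 / (4 * L)"
proof -
  assume "i < L"
  define a d where "a = real i / (4 * real L)" and "d = 1 / (4 * real L)"
  have "1 + real i \<le> real L"
    using \<open>i < L\<close> by linarith
  then have bounds: "0 \<le> a" "0 \<le> d" "a + d \<le> 1 / 4"
    using \<open>i < L\<close> by (simp_all add: a_def d_def field_simps)
  have iff: "block L t = Suc i \<longleftrightarrow> 1 / 2 + a \<le> t \<and> t < 1 / 2 + (a + d)" for t
    using block_eq_Suc_iff[of L t i] \<open>i < L\<close> by (simp add: a_def d_def add_divide_distrib add_ac)
  have "t \<in> {0..1} \<inter> {t. block L t = Suc i} \<longleftrightarrow> t \<in> {1 / 2 + a..<1 / 2 + (a + d)}" for t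
    unfolding Int_iff mem_Collect_eq atLeastAtMost_iff atLeastLessThan_iff iff
    using bounds by (intro iffI conjI; linarith)
  then have "{0..1} \<inter> {t. block L t = Suc i} = {1 / 2 + a..<1 / 2 + (a + d)}"
    by blast
  then show ?thesis
    using \<open>0 \<le> d\<close> by (subst measure_uniform01) (auto simp: d_def)
qed

lemma prob_block_gt: "L > 0 \<Longrightarrow> measure uniform01 {t. L < block L t} = 1 / 4"
proof -
  assume "L > 0"
  then have "{0..1} \<inter> {t. L < block L t} = {3 / 4..1}"
    by (auto simp: block_gt_iff)
  then show ?thesis by (subst measure_uniform01) auto
qed

lemma prob_space_green_times: "prob_space (green_times G)"
  unfolding green_times_def by (intro prob_space_PiM prob_space_uniform01)

lemma measurable_arrival_time:
  "(\<lambda>x. arrival_time G r x e) \<in> borel_measurable (green_times G)"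
proof (cases "e \<in> G")
  case True
  then have "(\<lambda>x. x e) \<in> measurable (green_times G) uniform01"
    unfolding green_times_def by (rule measurable_component_singleton)
  then show ?thesis using True by (simp add: arrival_time_def cong: measurable_cong_sets)
qed (simp add: arrival_time_def)

lemma prob_green_times_box:
  assumes G: "finite G" "g \<in> G" "g' \<in> G" "g \<noteq> g'"
    and X: "X \<in> sets borel" "Y \<in> sets borel" "\<And>e. Z e \<in> sets borel"
  shows "measure (green_times G)
      {x \<in> space (green_times G). x g \<in> X \<and> x g' \<in> Y \<and> (\<forall>e\<in>G - {g, g'}. x e \<in> Z e)} =
    measure uniform01 X * measure uniform01 Y * (\<Prod>e\<in>G - {g, g'}. measure uniform01 (Z e))"
proof -
  interpret U: prob_space uniform01 by (rule prob_space_uniform01)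
  interpret product_prob_space "\<lambda>_. uniform01" G
    by unfold_locales
  interpret finite_product_prob_space "\<lambda>_. uniform01" G
    by unfold_locales (rule G(1))
  define W where "W e = (if e = g then X else if e = g' then Y else Z e)" for e
  have "{x \<in> space (green_times G). x g \<in> X \<and> x g' \<in> Y \<and> (\<forall>e\<in>G - {g, g'}. x e \<in> Z e)} = Pi\<^sub>E G W"
    using G unfolding green_times_def
    by (auto simp: space_PiM PiE_def extensional_def Pi_iff W_def split: if_splits)
  also have "measure (green_times G) (Pi\<^sub>E G W) = (\<Prod>e\<in>G. measure uniform01 (W e))"
    unfolding green_times_def by (rule finite_measure_PiM_emb) (use X in \<open>auto simp: W_def\<close>)
  also have "\<dots> = measure uniform01 (W g) * (\<Prod>e\<in>G - {g}. measure uniform01 (W e))"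
    by (rule prod.remove) (use G in auto)
  also have "(\<Prod>e\<in>G - {g}. measure uniform01 (W e)) =
      measure uniform01 (W g') * (\<Prod>e\<in>G - {g} - {g'}. measure uniform01 (W e))"
    by (rule prod.remove) (use G in auto)
  also have "(\<Prod>e\<in>G - {g} - {g'}. measure uniform01 (W e)) =
      (\<Prod>e\<in>G - {g, g'}. measure uniform01 (Z e))"
    by (rule prod.cong) (auto simp: W_def)
  finally show ?thesis using G by (simp add: W_def)
qed

section \<open>Averaging over seeds and over blocks\<close>

lemma measure_byzantine_seed_pair:
  assumes M: "prob_space M" and L: "L > 0" and W: "W \<in> sets (byzantine_seed L \<Otimes>\<^sub>M M)"
  shows "measure (byzantine_seed L \<Otimes>\<^sub>M M) W =
    (\<Sum>s<2 * L. measure M (Pair (real s) -` W)) / (2 * L)"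
proof -
  interpret prob_space M by fact
  have "emeasure (byzantine_seed L \<Otimes>\<^sub>M M) W =
      (\<integral>\<^sup>+\<omega>. emeasure M (Pair \<omega> -` W) \<partial>byzantine_seed L)"
    by (rule emeasure_pair_measure_alt[OF W])
  also have "\<dots> = (\<Sum>\<omega>\<in>real ` {..<2 * L}. ennreal (1 / (2 * L)) * emeasure M (Pair \<omega> -` W))"
    unfolding byzantine_seed_def uniform_count_measure_def
    by (subst nn_integral_point_measure_finite) (auto simp: card_image)
  also have "\<dots> = (\<Sum>s<2 * L. ennreal (1 / (2 * L)) * emeasure M (Pair (real s) -` W))"
    by (subst sum.reindex) auto
  also have "\<dots> = ennreal (\<Sum>s<2 * L. 1 / (2 * L) * measure M (Pair (real s) -` W))"
  proof -
    have "ennreal (1 / (2 * L)) * emeasure M (Pair (real s) -` W) =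
        ennreal (1 / (2 * L) * measure M (Pair (real s) -` W))" for s
      unfolding emeasure_eq_measure by (rule ennreal_mult[symmetric]) auto
    then show ?thesis by (simp only:) (rule sum_ennreal, simp)
  qed
  finally have "measure (byzantine_seed L \<Otimes>\<^sub>M M) W =
      (\<Sum>s<2 * L. 1 / (2 * L) * measure M (Pair (real s) -` W))"
    unfolding measure_def[of "byzantine_seed L \<Otimes>\<^sub>M M"]
    by (simp only: enn2real_ennreal sum_nonneg measure_nonneg zero_le_mult_iff zero_le_divide_1_iff of_nat_0_le_iff simp_thms)
  then show ?thesis by (simp add: sum_divide_distrib)
qed

lemma sum_lessThan_double:
  fixes f :: "nat \<Rightarrow> real"
  shows "(\<Sum>s<2 * L. f s) = (\<Sum>i<L. f i) + (\<Sum>i<L. f (L + i))"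
proof -
  have "(\<Sum>s<m + l. f s) = (\<Sum>i<m. f i) + (\<Sum>i<l. f (m + i))" for m l :: nat
    by (induction l) auto
  from this[of L L] show ?thesis by (simp add: mult_2)
qed

lemma sum_indicator_lessThan:
  fixes L :: nat
  shows "(\<Sum>i<L. indicator (E i) x :: real) = card {i. i < L \<and> x \<in> E i}"
proof -
  have "(\<Sum>i<L. indicator (E i) x :: real) = card ({..<L} \<inter> {i. x \<in> E i})"
    unfolding indicator_def of_bool_def by (subst sum.If_cases) simp_all
  also have "{..<L} \<inter> {i. x \<in> E i} = {i. i < L \<and> x \<in> E i}"
    by auto
  finally show ?thesis .
qed

text \<open>Each count is a sum of indicators, so taking expectations turns the pointwise bound on
  \<open>C\<close> into a bound on sums of probabilities.\<close>

lemma (in prob_space) sum_prob_ge: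
  fixes k L :: nat
  assumes C: "C \<in> events" and E: "\<And>i. E i \<in> events" and F: "\<And>i. F i \<in> events"
    and card: "\<And>x. x \<in> C \<Longrightarrow> k \<le> card {i. i < L \<and> x \<in> E i} + card {i. i < L \<and> x \<in> F i}"
  shows "k * prob C \<le> (\<Sum>i<L. prob (E i)) + (\<Sum>i<L. prob (F i))"
proof -
  have "k * prob C = expectation (\<lambda>x. real k * indicat_real C x)"
    using C by simp
  also have "\<dots> \<le> expectation (\<lambda>x. (\<Sum>i<L. indicat_real (E i) x) + (\<Sum>i<L. indicator (F i) x))"
  proof (rule integral_mono)
    show "integrable M (\<lambda>x. real k * indicat_real C x)"
      using C by (intro integrable_mult_right integrable_real_indicator) (auto simp: emeasure_eq_measure)
    show "integrable M (\<lambda>x. (\<Sum>i<L. indicator (E i) x) + (\<Sum>i<L. indicator (F i) x) :: real)"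
      using E F
      by (intro Bochner_Integration.integrable_add Bochner_Integration.integrable_sum
          integrable_real_indicator) (auto simp: emeasure_eq_measure)
    show "real k * indicat_real C x \<le> ((\<Sum>i<L. indicator (E i) x) + (\<Sum>i<L. indicator (F i) x) :: real)" for x
      using card[of x] unfolding sum_indicator_lessThan by (cases "x \<in> C") auto
  qed
  also have "\<dots> = (\<Sum>i<L. prob (E i)) + (\<Sum>i<L. prob (F i))"
    using E F
    by (subst Bochner_Integration.integral_add)
      (auto intro!: Bochner_Integration.integrable_sum integrable_real_indicator
        simp: emeasure_eq_measure)
  finally show ?thesis .
qed

section \<open>Success probability of the algorithm\<close>

lemma g_max_properties:
  assumes "finite G" "G \<noteq> {}"
  shows "g_max v G \<in> G" "\<And>e. e \<in> G \<Longrightarrow> v e \<le> v (g_max v G)"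
proof -
  have "Max (v ` G) \<in> v ` G"
    using assms by (intro Max_in) auto
  then obtain m where m: "m \<in> G" "v m = Max (v ` G)" by auto
  have "g_max v G \<in> G \<and> (\<forall>e\<in>G. v e \<le> v (g_max v G))"
    unfolding g_max_def arg_max_on_def
  proof (rule arg_maxI[where x = m])
    show "\<not> v y > v m" if "y \<in> G" for y
    proof -
      have "v y \<le> Max (v ` G)" by (rule Max_ge) (use that assms in auto)
      then show ?thesis using m by simp
    qed
  qed (use m in \<open>auto simp: not_less\<close>)
  then show "g_max v G \<in> G" "\<And>e. e \<in> G \<Longrightarrow> v e \<le> v (g_max v G)" by auto
qed

lemma success_prob_byzantine_ge:
  assumes inst: "byzantine_instance n G r" and card: "card G \<ge> 2"
    and n: "n \<le> 2 ^ k" and k: "k > 0"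
  defines "L \<equiv> 5 * k"
  shows "success_prob (byzantine_seed L) (byzantine_rule L) n G v r \<ge> 1 / (1600 * real k)"
proof -
  let ?M = "green_times G" and ?t = "arrival_time G r"
  interpret M: prob_space ?M by (rule prob_space_green_times)
  have L: "L > 0" using k by (simp add: L_def)
  have G: "G \<subseteq> {..<n}" using inst by (simp add: byzantine_instance_def)
  then have fin: "finite G" by (rule finite_subset) simp
  define g' where "g' = g_max v G"
  have "G \<noteq> {}" using card by auto
  then have g': "g' \<in> G" "\<And>e. e \<in> G \<Longrightarrow> v e \<le> v g'"
    using g_max_properties[OF fin] by (auto simp: g'_def)
  have "G - {g'} \<noteq> {}"
    using card fin g' by (metis One_nat_def card.empty card.insert_remove card_Diff_singleton
        diff_is_0_eq empty_iff not_less_eq_eq numeral_2_eq_2)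
  then have "Max (v ` (G - {g'})) \<in> v ` (G - {g'})"
    using fin by (intro Max_in) auto
  then obtain g where g: "g \<in> G" "g \<noteq> g'" "OPT v (G - {g_max v G}) = v g"
    by (auto simp: OPT_def g'_def)
  have lt: "g < n" "g' < n" using g g' G by auto

  \<comment> \<open>Emptiness of block \<open>Suc i\<close> is split into a deterministic condition
    on the red items and one condition per green coordinate. The coordinates \<open>g\<close> and
    \<open>g'\<close> are left out, which makes it independent of their arrival times.\<close>
  define avoid where "avoid i x \<longleftrightarrow> (\<forall>e<n. e \<notin> G \<longrightarrow> v g \<le> v e \<longrightarrow> block L (r e) \<noteq> Suc i) \<and>
    (\<forall>e\<in>G - {g, g'}. x e \<in> {t. v g \<le> v e \<longrightarrow> block L t \<noteq> Suc i})" for i and x :: "nat \<Rightarrow> real"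
  define \<beta> where "\<beta> i = M.prob {x \<in> space ?M. avoid i x}" for i
  have indep: "M.prob {x \<in> space ?M. x g \<in> X \<and> x g' \<in> Y \<and> avoid i x} =
      measure uniform01 X * measure uniform01 Y * \<beta> i"
    if "X \<in> sets borel" "Y \<in> sets borel" for X Y i
  proof -
    let ?R = "\<forall>e<n. e \<notin> G \<longrightarrow> v g \<le> v e \<longrightarrow> block L (r e) \<noteq> Suc i"
    let ?Z = "\<lambda>e. {t. v g \<le> v e \<longrightarrow> block L t \<noteq> Suc i}"
    have Z: "?Z e \<in> sets borel" for e by measurable
    interpret U: prob_space uniform01 by (rule prob_space_uniform01)
    show ?thesis
    \<comment> \<open>The red times are fixed, so the red condition holds surely or never.\<close>
    proof (cases ?R)
      case True
      then show ?thesis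
        using prob_green_times_box[OF fin g(1) g'(1) g(2) that Z]
          prob_green_times_box[OF fin g(1) g'(1) g(2) _ _ Z, of UNIV UNIV] U.prob_space
        by (simp add: \<beta>_def avoid_def)
    next
      case False
      then have "avoid i x = False" for x unfolding avoid_def by blast
      then show ?thesis by (simp add: \<beta>_def)
    qed
  qed

  define W where "W = {z \<in> space (byzantine_seed L \<Otimes>\<^sub>M ?M). case z of (\<omega>, x) \<Rightarrow>
      \<exists>e. selects (byzantine_rule L \<omega>) n v (?t x) e \<and> v g \<le> v e}"
  have W: "W \<in> sets (byzantine_seed L \<Otimes>\<^sub>M ?M)"
    using measurable_selects[OF online_algorithm_byzantine[OF L],
        where t = "\<lambda>e x. ?t x e" and P = "\<lambda>e. v g \<le> v e", OF measurable_arrival_time]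
    unfolding W_def pred_def .
  have space_seed: "real s \<in> space (byzantine_seed L)" if "s < 2 * L" for s
    using that by (simp add: byzantine_seed_def space_uniform_count_measure)
  have search: "Pair (real i) -` W =
      {x \<in> space ?M. \<exists>e. selects (search_rule L i) n v (?t x) e \<and> v g \<le> v e}" if "i < L" for i
    using that space_seed[of i]
    by (auto simp: W_def space_pair_measure byzantine_rule_def[abs_def])
  have sample: "Pair (real (L + i)) -` W =
      {x \<in> space ?M. \<exists>e. selects (sample_rule L i) n v (?t x) e \<and> v g \<le> v e}" if "i < L" for i
  proof -
    have "nat \<lfloor>real (L + i)\<rfloor> = L + i" by (simp only: floor_of_nat nat_int)
    then have "byzantine_rule L (real (L + i)) = sample_rule L i"
      by (simp add: byzantine_rule_def[abs_def] del: of_nat_add)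
    then show ?thesis
      using that space_seed[of "L + i"] by (auto simp: W_def space_pair_measure)
  qed

  \<comment> \<open>The counting bound is averaged over the event that \<open>g\<close> arrives
    before time 1/2. That event has probability 1/2 and is independent of \<open>avoid\<close>, so
    each empty block contributes \<beta> i / 2.\<close>
  have search_ge: "(k - (\<Sum>i<L. \<beta> i)) / 2 \<le> (\<Sum>i<L. M.prob (Pair (real i) -` W))"
  proof -
    let ?C = "{x \<in> space ?M. block L (x g) = 0}"
    let ?F = "\<lambda>i. {x \<in> space ?M. x g \<in> {t. block L t = 0} \<and> x g' \<in> UNIV \<and> avoid i x}"
    have [measurable]: "(\<lambda>x. x e) \<in> borel_measurable ?M" if "e \<in> G" for e
      using measurable_arrival_time[of G r e] that by (simp add: arrival_time_def)
    have sum_le: "k * M.prob ?C \<le> (\<Sum>i<L. M.prob (Pair (real i) -` W)) + (\<Sum>i<L. M.prob (?F i))"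
    proof (rule M.sum_prob_ge)
      show "?C \<in> M.events"
        using g(1) by measurable
      show "Pair (real i) -` W \<in> M.events" for i
        using W by (rule sets_Pair1)
      show "?F i \<in> M.events" for i
        unfolding avoid_def using g(1) fin by measurable
      fix x assume x: "x \<in> ?C"
      have "k \<le> card {i. i < L \<and> (\<exists>e. selects (search_rule L i) n v (?t x) e \<and> v g \<le> v e)} +
          card {i. i < L \<and> (\<forall>e<n. v g \<le> v e \<longrightarrow> block L (?t x e) \<noteq> Suc i)}"
        using x g lt n by (intro card_search_rule_succeeds_ge) (auto simp: arrival_time_def L_def)
      moreover have "(\<exists>e. selects (search_rule L i) n v (?t x) e \<and> v g \<le> v e) \<longleftrightarrow>
          x \<in> Pair (real i) -` W" if "i < L" for i
        unfolding search[OF that] using x by simp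
      then have "{i. i < L \<and> (\<exists>e. selects (search_rule L i) n v (?t x) e \<and> v g \<le> v e)} =
          {i. i < L \<and> x \<in> Pair (real i) -` W}"
        by (intro Collect_cong conj_cong refl)
      \<comment> \<open>Here \<open>g\<close> lies in block 0, and \<open>avoid\<close> drops the
        condition on \<open>g'\<close>, so the set of blocks can only grow.\<close>
      moreover have "card {i. i < L \<and> (\<forall>e<n. v g \<le> v e \<longrightarrow> block L (?t x e) \<noteq> Suc i)} \<le>
          card {i. i < L \<and> x \<in> ?F i}"
        using x G by (intro card_mono) (auto simp: avoid_def arrival_time_def split: if_splits)
      ultimately show "k \<le> card {i. i < L \<and> x \<in> Pair (real i) -` W} + card {i. i < L \<and> x \<in> ?F i}"
        by simp
    qed
    have prob_F: "M.prob (?F i) = \<beta> i / 2" for i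
      using indep[of "{t. block L t = 0}" UNIV i] prob_block_eq_0[OF L]
        prob_space.prob_space[OF prob_space_uniform01] by simp
    have prob_C: "M.prob ?C = 1 / 2"
      using prob_green_times_box[OF fin g(1) g'(1) g(2), of "{t. block L t = 0}" UNIV "\<lambda>_. UNIV"]
        prob_block_eq_0[OF L] prob_space.prob_space[OF prob_space_uniform01] by simp
    show ?thesis
      using sum_le unfolding prob_F prob_C sum_divide_distrib[symmetric] by simp
  qed

  have sample_ge: "\<beta> i / (16 * L) \<le> M.prob (Pair (real (L + i)) -` W)" if i: "i < L" for i
  proof -
    have "\<beta> i / (16 * L) =
        M.prob {x \<in> space ?M. x g \<in> {t. block L t = Suc i} \<and> x g' \<in> {t. L < block L t} \<and> avoid i x}"
      using indep[of "{t. block L t = Suc i}" "{t. L < block L t}" i]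
        prob_block_eq_Suc[OF i] prob_block_gt[OF L] by simp
    also have "\<dots> \<le> M.prob (Pair (real (L + i)) -` W)"
    proof (rule M.finite_measure_mono)
      show "Pair (real (L + i)) -` W \<in> M.events"
        using W by (rule sets_Pair1)
      show "{x \<in> space ?M. x g \<in> {t. block L t = Suc i} \<and> x g' \<in> {t. L < block L t} \<and> avoid i x}
          \<subseteq> Pair (real (L + i)) -` W"
      proof
        fix x
        assume "x \<in> {x \<in> space ?M. x g \<in> {t. block L t = Suc i} \<and>
          x g' \<in> {t. L < block L t} \<and> avoid i x}"
        then have x: "x \<in> space ?M" "block L (x g) = Suc i" "L < block L (x g')" "avoid i x"
          by auto
        have others: "v e < v g" if e: "e < n" "e \<noteq> g" "block L (?t x e) = Suc i" for e
        proof (rule ccontr)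
          assume "\<not> v e < v g"
          \<comment> \<open>The item \<open>g'\<close> arrives in a block beyond \<open>L\<close>,
            hence not in block \<open>Suc i\<close>.\<close>
          moreover have "e \<noteq> g'" using e x i g' by (auto simp: arrival_time_def)
          ultimately show False
            using x(4) e by (auto simp: avoid_def arrival_time_def split: if_splits)
        qed
        have times: "block L (?t x g) = Suc i" "Suc i < block L (?t x g')" "v g \<le> v g'"
          using x i g g' by (auto simp: arrival_time_def)
        have "\<exists>e. selects (sample_rule L i) n v (?t x) e \<and> v g \<le> v e"
          by (rule sample_rule_succeeds[where g = g and g' = g' and b = "v g"])
            (fact lt times others refl)+
        then show "x \<in> Pair (real (L + i)) -` W"
          unfolding sample[OF i] using x(1) by blast
      qed
    qed
    finally show ?thesis .
  qed

  have success_eq: "success_prob (byzantine_seed L) (byzantine_rule L) n G v r =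
      measure (byzantine_seed L \<Otimes>\<^sub>M ?M) W"
    by (simp add: success_prob_def W_def g(3) case_prod_unfold)
  define s where "s = (\<Sum>i<L. \<beta> i)"
  \<comment> \<open>Here \<open>s\<close> is the expected number of empty blocks. It may exceed
    \<open>k\<close>, which makes the bound \<open>search_ge\<close> negative; hence the maximum
    with 0.\<close>
  have "max 0 ((k - s) / 2) + s / (16 * L) \<le>
      (\<Sum>i<L. M.prob (Pair (real i) -` W)) + (\<Sum>i<L. M.prob (Pair (real (L + i)) -` W))"
  proof (rule add_mono)
    show "max 0 ((k - s) / 2) \<le> (\<Sum>i<L. M.prob (Pair (real i) -` W))"
      using search_ge by (simp add: s_def sum_nonneg)
    show "s / (16 * L) \<le> (\<Sum>i<L. M.prob (Pair (real (L + i)) -` W))"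
      unfolding s_def sum_divide_distrib by (rule sum_mono) (simp only: sample_ge lessThan_iff)
  qed
  also have "\<dots> = success_prob (byzantine_seed L) (byzantine_rule L) n G v r * (2 * L)"
    using measure_byzantine_seed_pair[OF prob_space_green_times L W] L
    unfolding success_eq sum_lessThan_double by simp
  finally have success: "max 0 ((k - s) / 2) + s / (16 * L) \<le>
    success_prob (byzantine_seed L) (byzantine_rule L) n G v r * (2 * L)" .
  define p where "p = success_prob (byzantine_seed L) (byzantine_rule L) n G v r"
  have s: "s \<ge> 0" by (simp add: s_def \<beta>_def sum_nonneg)
  have "1 / 1600 \<le> p * k"
  \<comment> \<open>With \<open>L = 5 * k\<close>, few empty blocks give k / 4 \<le> 10 * k * p from
    searching alone, and many give 1 / 160 \<le> 10 * k * p from sampling alone.\<close>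
  proof (cases "s \<le> k / 2")
    case True
    have "real k / 4 \<le> max 0 ((k - s) / 2)"
      using True by (simp add: field_simps le_max_iff_disj)
    also have "\<dots> \<le> max 0 ((k - s) / 2) + s / (16 * L)"
      using s by simp
    also have "\<dots> \<le> p * (2 * L)"
      using success by (simp only: p_def)
    finally have "real k / 4 \<le> p * (2 * L)" .
    then have "1 / 40 \<le> p"
      using k by (simp add: L_def field_simps)
    moreover have "p * 1 \<le> p * k"
      using k calculation by (intro mult_left_mono) auto
    ultimately show ?thesis by linarith
  next
    case False
    then have "real k / 2 / (16 * L) \<le> s / (16 * L)"
      by (intro divide_right_mono) auto
    also have "\<dots> \<le> max 0 ((k - s) / 2) + s / (16 * L)"
      by simp
    also have "\<dots> \<le> p * (2 * L)"
      using success by (simp only: p_def)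
    finally have "real k / 2 / (16 * L) \<le> p * (2 * L)" .
    then show ?thesis
      using k by (simp add: L_def field_simps)
  qed
  then show ?thesis
    using k by (simp add: p_def field_simps)
qed

section \<open>From powers of two to the natural logarithm\<close>

text \<open>Since 2 * ln 2 is at least 1, the power 2^(2 * ln n) is at least n for positive
  n.\<close>

lemma le_two_power_Suc_nat_floor: "n \<le> 2 ^ Suc (nat \<lfloor>2 * ln (real n)\<rfloor>)"
proof (cases "n = 0")
  case False
  let ?k = "Suc (nat \<lfloor>2 * ln (real n)\<rfloor>)"
  have k: "2 * ln n \<le> ?k" by linarith
  have "ln n \<le> 2 * ln n * ln 2"
    using ln2_ge_two_thirds mult_left_mono[of "1 / 2" "ln 2" "2 * ln n"] False by simp
  also have "\<dots> \<le> ?k * ln 2"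
    using k by (intro mult_right_mono) auto
  also have "\<dots> = ln (2 ^ ?k)"
    by (subst ln_realpow) simp_all
  finally have "real n \<le> 2 ^ ?k"
    using False by (subst (asm) ln_le_cancel_iff) auto
  then have "real n \<le> real (2 ^ ?k)" by simp
  then show ?thesis by (simp only: of_nat_le_iff)
qed simp

theorem theorem1p4:
  "\<exists>(S :: nat \<Rightarrow> real measure) (A :: nat \<Rightarrow> real \<Rightarrow> (real \<times> real) list \<Rightarrow> bool) (c :: real).
     c > 0 \<and>
     (\<forall>n. online_algorithm (S n) (A n)) \<and>
     (\<forall>n G v r. byzantine_instance n G r \<and> card G \<ge> 2 \<longrightarrow>
        success_prob (S n) (A n) n G v r \<ge> c / ln (real n))"
proof -
  define k where "k n = Suc (nat \<lfloor>2 * ln (real n)\<rfloor>)" for n :: nat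
  have "success_prob (byzantine_seed (5 * k n)) (byzantine_rule (5 * k n)) n G v r \<ge>
      (1 / 6400) / ln (real n)"
    if inst: "byzantine_instance n G r" and card: "card G \<ge> 2" for n G v r
  proof -
    have "card G \<le> n"
      using inst card_mono[of "{..<n}" G] by (simp add: byzantine_instance_def)
    then have "2 \<le> real n" using card by simp
    then have ln: "1 / 2 \<le> ln (real n)"
      using ln2_ge_two_thirds ln_le_cancel_iff[of 2 "real n"] by linarith
    then have "real (k n) \<le> 2 * ln n + 1"
      unfolding k_def by linarith
    \<comment> \<open>Two green items force n \<ge> 2, so 1 \<le> 2 * ln n absorbs the rounding
      term: \<open>k n\<close> is at most 4 * ln n.\<close>
    then have "1600 * real (k n) \<le> 6400 * ln n" using ln by linarith
    moreover have "0 < real (k n)" by (simp add: k_def)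
    ultimately have "1 / (6400 * ln n) \<le> 1 / (1600 * real (k n))"
      by (intro frac_le) auto
    then have "(1 / 6400) / ln (real n) \<le> 1 / (1600 * real (k n))"
      by simp
    also have "\<dots> \<le> success_prob (byzantine_seed (5 * k n)) (byzantine_rule (5 * k n)) n G v r"
      using le_two_power_Suc_nat_floor[of n]
      by (intro success_prob_byzantine_ge inst card) (auto simp: k_def)
    finally show ?thesis .
  qed
  moreover have "online_algorithm (byzantine_seed (5 * k n)) (byzantine_rule (5 * k n))" for n
    by (rule online_algorithm_byzantine) (simp add: k_def)
  ultimately show ?thesis
    by (intro exI[of _ "\<lambda>n. byzantine_seed (5 * k n)"] exI[of _ "\<lambda>n. byzantine_rule (5 * k n)"]
        exI[of _ "1 / 6400"]) simp
qed

end
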